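(* Let $r,k$ be positive integers. Then \[\mathcal{P}^{(r,k)}(q,t)=\prod_{i=0}^{k-1}\mathcal{P}^{(r,1)}(q,q^it).\]
   Context: For positive integers $r,k$, an $(r,k)$-parking function of length $n$ is a sequence $(a_1,\dots,a_n)$ of positive integers whose increasing rearrangement $b_1\le\cdots\le b_n$ satisfies $b_i\le k+(i-1)r$; the empty sequence is the unique one of length $0$. For such $\alpha=(a_1,\dots,a_n)$ set $s^{(r,k)}(\alpha)=kn+\binom n2 r-\sum_{i=1}^n a_i$. For a sequence $\beta$ of positive integers in which the value $i$ occurs $m_i$ times, let $U_\beta=h_{m_1}h_{m_2}\cdots$ (with $h_0=1$, $h_m$ the complete homogeneous symmetric function). Define $F_n^{(r,k)}(q)=\sum_\beta q^{s^{(r,k)}(\beta)}U_\beta$, the sum over all weakly increasing $(r,k)$-parking functions $\beta$ of length $n$ (so $F_0^{(r,k)}(q)=1$), and $\mathcal{P}^{(r,k)}(q,t)=\sum_{n\ge0}F_n^{(r,k)}(q)t^n$. *)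

theory Defs
  imports "HOL-Computational_Algebra.Computational_Algebra" "HOL-Library.Poly_Mapping"
begin

text \<open>
  Symmetric functions are certain formal power series in infinitely many variables
  \<open>x\<^sub>0, x\<^sub>1, x\<^sub>2, \<dots>\<close>.  A monomial is a finitely supported exponent vector
  \<open>nat \<Rightarrow>\<^sub>0 nat\<close>, and a series is an arbitrary family of integer coefficients indexed by the
  monomials.  The ring of symmetric functions is a subring of the ring defined here.
\<close>

typedef mvps = "UNIV :: ((nat \<Rightarrow>\<^sub>0 nat) \<Rightarrow> int) set"
  morphisms mcoeff Abs_mvps ..

setup_lifting type_definition_mvps

lemma mvps_eqI: "(\<And>m. mcoeff f m = mcoeff g m) \<Longrightarrow> f = g"
  by (metis ext mcoeff_inject)

definition splits :: "(nat \<Rightarrow>\<^sub>0 nat) \<Rightarrow> ((nat \<Rightarrow>\<^sub>0 nat) \<times> (nat \<Rightarrow>\<^sub>0 nat)) set" where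
  "splits m = {(a, b). a + b = m}"

lemma finite_divisors: "finite {a :: nat \<Rightarrow>\<^sub>0 nat. \<exists>b. a + b = m}"
proof -
  let ?D = "{a :: nat \<Rightarrow>\<^sub>0 nat. \<exists>b. a + b = m}"
  let ?K = "Poly_Mapping.keys m"
  let ?B = "{f. \<forall>i. (i \<in> ?K \<longrightarrow> f i \<in> {..\<Sum>j\<in>?K. Poly_Mapping.lookup m j}) \<and> (i \<notin> ?K \<longrightarrow> f i = 0)}"
  have "finite ?B"
    by (rule finite_set_of_finite_funs) auto
  moreover have "Poly_Mapping.lookup ` ?D \<subseteq> ?B"
  proof clarsimp
    fix a b :: "nat \<Rightarrow>\<^sub>0 nat" and i
    assume m: "m = a + b"
    have le: "Poly_Mapping.lookup a i \<le> Poly_Mapping.lookup m i"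
      by (simp add: m lookup_add)
    have "Poly_Mapping.lookup m i \<le> (\<Sum>j\<in>?K. Poly_Mapping.lookup m j)" if "i \<in> ?K"
      using that by (intro member_le_sum) auto
    with le m show "(i \<in> Poly_Mapping.keys (a + b) \<longrightarrow> Poly_Mapping.lookup a i \<le>
          (\<Sum>j\<in>Poly_Mapping.keys (a + b). Poly_Mapping.lookup (a + b) j)) \<and>
        (i \<notin> Poly_Mapping.keys (a + b) \<longrightarrow> Poly_Mapping.lookup a i = 0)"
      by (auto simp: in_keys_iff)
  qed
  ultimately have "finite (Poly_Mapping.lookup ` ?D)"
    by (rule rev_finite_subset)
  moreover have "inj_on Poly_Mapping.lookup ?D"
    by (auto intro!: inj_onI poly_mapping_eqI)
  ultimately show ?thesis
    using finite_imageD by blast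
qed

lemma finite_splits [simp, intro]: "finite (splits m)"
proof (rule finite_subset)
  show "splits m \<subseteq> {a. \<exists>b. a + b = m} \<times> {a. \<exists>b. a + b = m}"
    unfolding splits_def by (auto intro: add.commute)
qed (intro finite_cartesian_product finite_divisors)

instantiation mvps :: comm_ring_1
begin

lift_definition zero_mvps :: mvps is "\<lambda>_. 0" .
lift_definition one_mvps :: mvps is "\<lambda>m. if m = 0 then 1 else 0" .
lift_definition plus_mvps :: "mvps \<Rightarrow> mvps \<Rightarrow> mvps" is "\<lambda>f g m. f m + g m" .
lift_definition uminus_mvps :: "mvps \<Rightarrow> mvps" is "\<lambda>f m. - f m" .
lift_definition minus_mvps :: "mvps \<Rightarrow> mvps \<Rightarrow> mvps" is "\<lambda>f g m. f m - g m" .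
lift_definition times_mvps :: "mvps \<Rightarrow> mvps \<Rightarrow> mvps"
  is "\<lambda>f g m. \<Sum>(a, b)\<in>splits m. f a * g b" .

instance
proof
  fix f g h :: mvps
  show "f + g + h = f + (g + h)" "f + g = g + f" "0 + f = f" "- f + f = 0" "f - g = f + - g"
    by (transfer; simp add: algebra_simps)+
  show "(0::mvps) \<noteq> 1"
    by transfer (metis zero_neq_one)
  show "(f + g) * h = f * h + g * h"
    by transfer (simp add: algebra_simps sum.distrib case_prod_unfold)
  show "f * g = g * f"
  proof (transfer, rule ext)
    fix f g :: "(nat \<Rightarrow>\<^sub>0 nat) \<Rightarrow> int" and m
    show "(\<Sum>(a, b)\<in>splits m. f a * g b) = (\<Sum>(a, b)\<in>splits m. g a * f b)"
      by (rule sum.reindex_bij_witness[of _ prod.swap prod.swap])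
         (auto simp: splits_def add.commute mult.commute)
  qed
  show "1 * f = f"
  proof (transfer, rule ext)
    fix f :: "(nat \<Rightarrow>\<^sub>0 nat) \<Rightarrow> int" and m
    have "(\<Sum>(a, b)\<in>splits m. (if a = 0 then 1 else 0) * f b)
        = (\<Sum>(a, b)\<in>{(0 :: nat \<Rightarrow>\<^sub>0 nat, m)}. (if a = 0 then 1 else 0) * f b)"
      by (rule sum.mono_neutral_right) (simp, auto simp: splits_def split: if_splits)
    then show "(\<Sum>(a, b)\<in>splits m. (if a = 0 then 1 else 0) * f b) = f m"
      by simp
  qed
  show "f * g * h = f * (g * h)"
  proof (transfer, rule ext)
    fix f g h :: "(nat \<Rightarrow>\<^sub>0 nat) \<Rightarrow> int" and m
    have "(\<Sum>(a, b)\<in>splits m. (\<Sum>(c, d)\<in>splits a. f c * g d) * h b)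
        = (\<Sum>x\<in>splits m. \<Sum>y\<in>splits (fst x). f (fst y) * g (snd y) * h (snd x))"
      by (simp add: case_prod_unfold sum_distrib_right)
    also have "\<dots> = (\<Sum>(x, y)\<in>(SIGMA x:splits m. splits (fst x)). f (fst y) * g (snd y) * h (snd x))"
      by (rule sum.Sigma) auto
    also have "\<dots> = (\<Sum>(x, y)\<in>(SIGMA x:splits m. splits (snd x)). f (fst x) * (g (fst y) * h (snd y)))"
      by (rule sum.reindex_bij_witness[of _
            "\<lambda>((a, b), (c, d)). ((a + c, d), (a, c))" "\<lambda>((a, b), (c, d)). ((c, d + b), (d, b))"])
         (auto simp: splits_def algebra_simps)
    also have "\<dots> = (\<Sum>x\<in>splits m. \<Sum>y\<in>splits (snd x). f (fst x) * (g (fst y) * h (snd y)))"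
      by (rule sum.Sigma[symmetric]) auto
    also have "\<dots> = (\<Sum>(a, b)\<in>splits m. f a * (\<Sum>(c, d)\<in>splits b. g c * h d))"
      by (simp add: case_prod_unfold sum_distrib_left)
    finally show "(\<Sum>(a, b)\<in>splits m. (\<Sum>(c, d)\<in>splits a. f c * g d) * h b)
        = (\<Sum>(a, b)\<in>splits m. f a * (\<Sum>(c, d)\<in>splits b. g c * h d))" .
  qed
qed

end

text \<open>The complete homogeneous symmetric function: the sum of all monomials of total degree \<open>d\<close>.\<close>

lift_definition complete_sym :: "nat \<Rightarrow> mvps"
  is "\<lambda>d m. if (\<Sum>i\<in>Poly_Mapping.keys m. Poly_Mapping.lookup m i) = d then 1 else 0" .

lemma complete_sym_0: "complete_sym 0 = 1"
  by transfer (auto simp: fun_eq_iff in_keys_iff intro!: poly_mapping_eqI)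

text \<open>List positions start at 0, so \<open>sort a ! i\<close> is the entry \<open>b\<^sub>i\<^sub>+\<^sub>1\<close> of the increasing
  rearrangement.\<close>

definition parking_function :: "nat \<Rightarrow> nat \<Rightarrow> nat list \<Rightarrow> bool" where
  "parking_function r k a \<longleftrightarrow>
     (\<forall>x\<in>set a. 0 < x) \<and> (\<forall>i<length a. sort a ! i \<le> k + i * r)"

definition park_stat :: "nat \<Rightarrow> nat \<Rightarrow> nat list \<Rightarrow> int" where
  "park_stat r k a = int k * int (length a) + int (length a choose 2) * int r - int (sum_list a)"

text \<open>Values that do not occur in the list would contribute the factor \<open>complete_sym 0 = 1\<close>.\<close>

definition park_h :: "nat list \<Rightarrow> mvps" where
  "park_h b = (\<Prod>i\<in>set b. complete_sym (count_list b i))"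

definition increasing_parking_functions :: "nat \<Rightarrow> nat \<Rightarrow> nat \<Rightarrow> nat list set" where
  "increasing_parking_functions r k n = {b. parking_function r k b \<and> length b = n \<and> sorted b}"

text \<open>The conversion to \<^typ>\<open>nat\<close> in the exponent of \<open>q\<close> below loses nothing, and the sum is over
  a finite set.\<close>

lemma park_stat_nonneg:
  assumes "parking_function r k a"
  shows "0 \<le> park_stat r k a"
proof -
  have arith: "(\<Sum>i<n. k + i * r) = k * n + (n choose 2) * r" for n
    by (induction n) (simp_all add: numeral_2_eq_2 algebra_simps)
  have "sum_list a = sum_list (sort a)"
    by (metis mset_sort sum_mset_sum_list)
  also have "\<dots> = (\<Sum>i<length a. sort a ! i)"
    by (simp add: sum_list_sum_nth atLeast0LessThan)
  also have "\<dots> \<le> (\<Sum>i<length a. k + i * r)"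
    using assms by (intro sum_mono) (auto simp: parking_function_def)
  also have "\<dots> = k * length a + (length a choose 2) * r"
    by (rule arith)
  finally have "int (sum_list a) \<le> int (k * length a + (length a choose 2) * r)"
    by (simp only: of_nat_le_iff)
  then show ?thesis
    by (simp add: park_stat_def)
qed

lemma finite_increasing_parking_functions: "finite (increasing_parking_functions r k n)"
proof (rule finite_subset)
  show "increasing_parking_functions r k n \<subseteq> {b. set b \<subseteq> {..k + n * r} \<and> length b = n}"
  proof (clarsimp simp: increasing_parking_functions_def parking_function_def sorted_sort_id in_set_conv_nth)
    fix b i
    assume *: "\<forall>i<length b. b ! i \<le> k + i * r" and i: "i < length b"
    have "b ! i \<le> k + i * r" using * i by blast
    also have "\<dots> \<le> k + length b * r" using i by simp
    finally show "b ! i \<le> k + length b * r" .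
  qed
qed (auto intro: finite_lists_length_eq)

text \<open>The polynomial variable of \<^typ>\<open>mvps poly\<close> is \<open>q\<close>; the variable of
  \<^typ>\<open>mvps poly fps\<close> is \<open>t\<close>.\<close>

definition q_var :: "mvps poly" where
  "q_var = monom 1 1"

definition park_poly :: "nat \<Rightarrow> nat \<Rightarrow> nat \<Rightarrow> mvps poly" where
  "park_poly r k n = (\<Sum>b\<in>increasing_parking_functions r k n. smult (park_h b) (q_var ^ nat (park_stat r k b)))"

definition park_series :: "nat \<Rightarrow> nat \<Rightarrow> mvps poly fps" where
  "park_series r k = Abs_fps (park_poly r k)"

end

theory Submission
  imports Defs
begin

text \<open>
  Scan an increasing \<open>(r, k + 1)\<close>-parking function \<open>b\<close> up to the first position \<open>j\<close> (counted from 0)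
  with \<open>b ! j > 1 + j * r\<close>, or to the end if there is none.  The part before \<open>j\<close> is an
  \<open>(r, 1)\<close>-parking function, and the part from \<open>j\<close> on, lowered by \<open>1 + j * r\<close>, is an
  \<open>(r, k)\<close>-parking function.  This is the first-passage decomposition of the associated lattice path.
  Measured against the bound \<open>k + 1 + i * r\<close> instead of \<open>1 + i * r\<close>, each of the first \<open>j\<close> entries
  gains slack \<open>k\<close>, whereas the slack of the later entries is unchanged.  Hence the \<open>(r, k + 1)\<close>-series
  is the \<open>(r, k)\<close>-series times the \<open>(r, 1)\<close>-series at \<open>q\<^sup>k t\<close>.
\<close>

section \<open>Joining and splitting increasing parking functions\<close>

lemma increasing_parking_functions_iff:
  "b \<in> increasing_parking_functions r k n \<longleftrightarrow>
     sorted b \<and> length b = n \<and> (\<forall>x\<in>set b. 0 < x) \<and> (\<forall>i<n. b ! i \<le> k + i * r)"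
  by (auto simp: increasing_parking_functions_def parking_function_def sorted_sort_id)

definition park_join :: "nat \<Rightarrow> nat list \<Rightarrow> nat list \<Rightarrow> nat list" where
  "park_join r a b = a @ map (\<lambda>x. x + (1 + length a * r)) b"

text \<open>The disjunct \<open>length b \<le> j\<close> guarantees that the minimum exists, returns
  \<open>length b\<close> when no entry passes its bound, and keeps \<open>b ! j\<close> from
  mattering out of range.\<close>

definition park_split_index :: "nat \<Rightarrow> nat list \<Rightarrow> nat" where
  "park_split_index r b = (LEAST j. length b \<le> j \<or> 1 + j * r < b ! j)"

definition park_lower :: "nat \<Rightarrow> nat list \<Rightarrow> nat list" where
  "park_lower r b =
     (let j = park_split_index r b in map (\<lambda>x. x - (1 + j * r)) (drop j b))"

text \<open>Entries of \<open>b\<close> are positive, so in \<open>park_join r a b\<close> their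
  shifted values exceed \<open>1 + j * r\<close>. This bound on \<open>a\<close> thus gives both the
  sortedness of the join and the disjointness of the two value sets.\<close>

lemma set_parking_1_le:
  assumes "a \<in> increasing_parking_functions r 1 j" "x \<in> set a"
  shows "x \<le> 1 + j * r"
proof -
  obtain i where i: "i < j" "x = a ! i"
    using assms by (auto simp: increasing_parking_functions_iff in_set_conv_nth)
  then have "x \<le> 1 + i * r"
    using assms by (auto simp: increasing_parking_functions_iff)
  also have "\<dots> \<le> 1 + j * r" using i by simp
  finally show ?thesis .
qed

lemma park_join_in:
  assumes a: "a \<in> increasing_parking_functions r 1 j"
    and b: "b \<in> increasing_parking_functions r k m"
  shows "park_join r a b \<in> increasing_parking_functions r (Suc k) (j + m)"
proof -
  have len: "length a = j" "length b = m"
    using a b by (auto simp: increasing_parking_functions_iff)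
  have "sorted (map (\<lambda>x. x + (1 + j * r)) b)"
    using b by (auto simp: increasing_parking_functions_iff sorted_iff_nth_mono)
  moreover have "x \<le> y + (1 + j * r)" if "x \<in> set a" for x y
    using set_parking_1_le[OF a that] by simp
  moreover have "sorted a" using a by (simp add: increasing_parking_functions_iff)
  ultimately have "sorted (park_join r a b)"
    by (auto simp: park_join_def sorted_append len)
  moreover have "park_join r a b ! i \<le> Suc k + i * r" if "i < j + m" for i
  proof (cases "i < j")
    case True
    then have "a ! i \<le> 1 + i * r" using a by (auto simp: increasing_parking_functions_iff)
    with True show ?thesis by (simp add: park_join_def nth_append len)
  next
    case False
    then obtain l where l: "i = j + l" by (metis le_add_diff_inverse not_less)
    with that b have "b ! l \<le> k + l * r" by (auto simp: increasing_parking_functions_iff)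
    with l that show ?thesis by (simp add: park_join_def nth_append len algebra_simps)
  qed
  ultimately show ?thesis
    using a b by (auto simp: increasing_parking_functions_iff park_join_def)
qed

text \<open>Before \<open>j\<close> the bounds on \<open>a\<close> hold. At \<open>j\<close> either
  the list ends, or the positive entry \<open>b ! 0\<close> lifts the shifted value strictly above
  \<open>1 + j * r\<close>. So the join determines its two pieces.\<close>

lemma park_split_index_join:
  assumes a: "a \<in> increasing_parking_functions r 1 j"
    and b: "b \<in> increasing_parking_functions r k m"
  shows "park_split_index r (park_join r a b) = j"
  unfolding park_split_index_def
proof (rule Least_equality)
  have len: "length a = j" "length b = m"
    using a b by (auto simp: increasing_parking_functions_iff)
  show "length (park_join r a b) \<le> j \<or> 1 + j * r < park_join r a b ! j"
  proof (cases "m = 0")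
    case False
    then have "0 < b ! 0" using b by (auto simp: increasing_parking_functions_iff)
    with False show ?thesis by (simp add: park_join_def nth_append len)
  qed (simp add: park_join_def len)
  show "j \<le> i" if "length (park_join r a b) \<le> i \<or> 1 + i * r < park_join r a b ! i" for i
  proof (rule ccontr)
    assume "\<not> j \<le> i"
    moreover from this have "a ! i \<le> 1 + i * r"
      using a by (auto simp: increasing_parking_functions_iff)
    ultimately show False
      using that by (auto simp: park_join_def nth_append len)
  qed
qed

lemma
  assumes b: "b \<in> increasing_parking_functions r (Suc k) n"
  defines "j \<equiv> park_split_index r b"
  shows park_split_index_le: "j \<le> n"
    and take_split_in: "take j b \<in> increasing_parking_functions r 1 j"
    and park_lower_in: "park_lower r b \<in> increasing_parking_functions r k (n - j)"
    and park_join_split: "park_join r (take j b) (park_lower r b) = b"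
proof -
  have len: "length b = n" using b by (simp add: increasing_parking_functions_iff)
  show jn: "j \<le> n"
    unfolding j_def park_split_index_def by (rule Least_le) (simp add: len)
  have below: "b ! i \<le> 1 + i * r" if "i < j" for i
    using not_less_Least[OF that[unfolded j_def park_split_index_def]] by auto
  have "length b \<le> j \<or> 1 + j * r < b ! j"
    unfolding j_def park_split_index_def by (rule LeastI[of _ n]) (simp add: len)
  \<comment> \<open>Sortedness carries the first excess to every later position. Hence the
    subtraction in \<open>park_lower\<close> never truncates, leaves positive entries and is undone
    by the shift.\<close>
  then have above: "1 + j * r < b ! i" if "j \<le> i" "i < n" for i
    using that b sorted_nth_mono[of b j i]
    by (fastforce simp: increasing_parking_functions_iff)
  show "take j b \<in> increasing_parking_functions r 1 j"
    using b jn below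
    by (auto simp: increasing_parking_functions_iff sorted_wrt_take dest: in_set_takeD)
  have lower_nth: "park_lower r b ! i = b ! (j + i) - (1 + j * r)" if "i < n - j" for i
    using that by (simp add: park_lower_def Let_def j_def[symmetric] len)
  have lower_len: "length (park_lower r b) = n - j"
    by (simp add: park_lower_def Let_def j_def[symmetric] len)
  show "park_lower r b \<in> increasing_parking_functions r k (n - j)"
    unfolding increasing_parking_functions_iff
  proof (intro conjI allI impI ballI)
    show "sorted (park_lower r b)"
      unfolding sorted_iff_nth_mono lower_len
      using b len by (auto simp: lower_nth increasing_parking_functions_iff
          intro!: diff_le_mono sorted_nth_mono)
    show "length (park_lower r b) = n - j" by (fact lower_len)
    show "0 < x" if "x \<in> set (park_lower r b)" for x
    proof -
      from that obtain i where "i < n - j" "x = park_lower r b ! i"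
        unfolding in_set_conv_nth lower_len by blast
      with above[of "j + i"] show ?thesis by (auto simp: lower_nth)
    qed
    show "park_lower r b ! i \<le> k + i * r" if "i < n - j" for i
    proof -
      have "b ! (j + i) \<le> Suc k + (j + i) * r"
        using b that by (auto simp: increasing_parking_functions_iff)
      then show ?thesis using that by (simp add: lower_nth algebra_simps)
    qed
  qed
  have "map (\<lambda>x. x + (1 + j * r)) (park_lower r b) = drop j b"
  proof (rule nth_equalityI)
    fix i assume "i < length (map (\<lambda>x. x + (1 + j * r)) (park_lower r b))"
    then have i: "i < n - j" by (simp add: lower_len)
    then have "1 + j * r < b ! (j + i)" using above by simp
    with i show "map (\<lambda>x. x + (1 + j * r)) (park_lower r b) ! i = drop j b ! i"
      by (simp add: lower_len lower_nth len)
  qed (simp add: lower_len len)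
  then show "park_join r (take j b) (park_lower r b) = b"
    using jn by (simp add: park_join_def len min_def)
qed

lemma park_lower_join:
  assumes "a \<in> increasing_parking_functions r 1 j"
    and "b \<in> increasing_parking_functions r k m"
  shows "park_lower r (park_join r a b) = b"
proof -
  have "length a = j"
    using assms by (simp add: increasing_parking_functions_iff)
  then show ?thesis
    unfolding park_lower_def Let_def park_split_index_join[OF assms]
    by (simp add: park_join_def o_def)
qed

section \<open>Statistic and symmetric-function weight of a join\<close>

lemma choose_two_add: "(m + n) choose 2 = (m choose 2) + (n choose 2) + m * n"
  by (induction m) (simp_all add: numeral_2_eq_2)

text \<open>The cross term \<open>length a * length b * r\<close> from the binomial coefficient
  cancels against the shift of \<open>b\<close> by \<open>length a * r\<close>. The remaining shift
  by 1 turns the allowance \<open>Suc k\<close> into \<open>k\<close> on \<open>b\<close>, while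
  each entry of \<open>a\<close> keeps \<open>k\<close> beyond its allowance of 1.\<close>

lemma park_stat_join:
  "park_stat r (Suc k) (park_join r a b) =
     int (k * length a) + park_stat r 1 a + park_stat r k b"
proof -
  have "(\<Sum>x\<leftarrow>b. x + c) = sum_list b + c * length b" for c
    by (induction b) auto
  then have "sum_list (park_join r a b) = sum_list a + sum_list b + (1 + length a * r) * length b"
    unfolding park_join_def sum_list_append by (simp only: add.assoc)
  moreover have "length (park_join r a b) = length a + length b"
    by (simp add: park_join_def)
  ultimately show ?thesis
    by (simp add: park_stat_def choose_two_add algebra_simps)
qed

text \<open>The values of \<open>a\<close> and the shifted values of \<open>b\<close> are disjoint,
  and the shift is injective, so all multiplicities survive and the product splits.\<close>

lemma park_h_join:
  assumes a: "a \<in> increasing_parking_functions r 1 j"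
    and b: "b \<in> increasing_parking_functions r k m"
  shows "park_h (park_join r a b) = park_h a * park_h b"
proof -
  define f where "f = (\<lambda>x::nat. x + (1 + j * r))"
  have inj: "inj_on f A" for A by (auto simp: f_def inj_on_def)
  have join: "park_join r a b = a @ map f b"
    using a by (simp add: park_join_def f_def increasing_parking_functions_iff)
  have pos: "0 < x" if "x \<in> set b" for x
    using b that by (auto simp: increasing_parking_functions_iff)
  have disj: "set a \<inter> f ` set b = {}"
    using set_parking_1_le[OF a] pos by (fastforce simp: f_def)
  have "park_h (park_join r a b) =
      (\<Prod>i\<in>set a. complete_sym (count_list (a @ map f b) i)) *
      (\<Prod>i\<in>f ` set b. complete_sym (count_list (a @ map f b) i))"
    unfolding park_h_def join using disj by (simp add: prod.union_disjoint)
  also have "(\<Prod>i\<in>set a. complete_sym (count_list (a @ map f b) i)) = park_h a"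
    unfolding park_h_def
  proof (rule prod.cong)
    fix x assume "x \<in> set a"
    with disj have "x \<notin> set (map f b)" by auto
    then have "count_list (map f b) x = 0" by (metis count_list_0_iff)
    then show "complete_sym (count_list (a @ map f b) x) = complete_sym (count_list a x)"
      by simp
  qed simp
  also have "(\<Prod>i\<in>f ` set b. complete_sym (count_list (a @ map f b) i)) = park_h b"
    unfolding park_h_def prod.reindex[OF inj] o_def
  proof (rule prod.cong)
    fix x assume "x \<in> set b"
    with disj have "f x \<notin> set a" by auto
    then have "count_list a (f x) = 0" by (metis count_list_0_iff)
    moreover have "count_list (map f b) (f x) = count_list b x"
      by (induction b) (auto simp: f_def)
    ultimately show "complete_sym (count_list (a @ map f b) (f x)) = complete_sym (count_list b x)"
      by simp
  qed simp
  finally show ?thesis .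
qed

section \<open>Recursion in \<open>k\<close> for coefficients and series\<close>

lemma park_poly_Suc:
  "park_poly r (Suc k) n =
     (\<Sum>j=0..n. (q_var ^ k) ^ j * park_poly r 1 j * park_poly r k (n - j))"
proof -
  let ?I = "increasing_parking_functions r"
  let ?w = "\<lambda>k b. smult (park_h b) (q_var ^ nat (park_stat r k b))"
  have weight: "?w (Suc k) (park_join r a b) = (q_var ^ k) ^ j * ?w 1 a * ?w k b"
    if a: "a \<in> ?I 1 j" and b: "b \<in> ?I k m" for a b j m
  proof -
    \<comment> \<open>Nonnegativity makes \<open>nat\<close> additive on the three summands of
      \<open>park_stat_join\<close>.\<close>
    have "0 \<le> park_stat r 1 a" "0 \<le> park_stat r k b" "length a = j"
      using a b by (auto simp: increasing_parking_functions_def intro: park_stat_nonneg)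
    then have "nat (park_stat r (Suc k) (park_join r a b)) =
        k * j + nat (park_stat r 1 a) + nat (park_stat r k b)"
      by (simp add: park_stat_join nat_add_distrib del: of_nat_mult)
    then show ?thesis
      by (simp add: park_h_join[OF a b] power_add mult_ac flip: power_mult)
  qed
  have "park_poly r (Suc k) n =
      (\<Sum>(j, a, b)\<in>(SIGMA j:{0..n}. ?I 1 j \<times> ?I k (n - j)). ?w (Suc k) (park_join r a b))"
    unfolding park_poly_def
  \<comment> \<open>Recording the split position \<open>j\<close> in the triple groups the sum by
    the length of the first piece, which yields the Cauchy product.\<close>
  proof (rule sum.reindex_bij_witness[of _ "\<lambda>(j, a, b). park_join r a b"
        "\<lambda>b. (park_split_index r b, take (park_split_index r b) b, park_lower r b)"])
    fix b assume b: "b \<in> ?I (Suc k) n"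
    show "(case (park_split_index r b, take (park_split_index r b) b, park_lower r b) of
        (j, a, c) \<Rightarrow> park_join r a c) = b"
      using park_join_split[OF b] by simp
    show "(park_split_index r b, take (park_split_index r b) b, park_lower r b)
        \<in> (SIGMA j:{0..n}. ?I 1 j \<times> ?I k (n - j))"
      using park_split_index_le[OF b] take_split_in[OF b] park_lower_in[OF b] by simp
    show "(case (park_split_index r b, take (park_split_index r b) b, park_lower r b) of
        (j, a, c) \<Rightarrow> ?w (Suc k) (park_join r a c)) = ?w (Suc k) b"
      using park_join_split[OF b] by simp
  next
    fix p assume "p \<in> (SIGMA j:{0..n}. ?I 1 j \<times> ?I k (n - j))"
    then obtain j a b where p: "p = (j, a, b)" and j: "j \<le> n"
      and a: "a \<in> ?I 1 j" and b: "b \<in> ?I k (n - j)"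
      by auto
    have "take j (park_join r a b) = a"
      using a by (simp add: park_join_def increasing_parking_functions_iff)
    then show "(park_split_index r (case p of (j, a, b) \<Rightarrow> park_join r a b),
          take (park_split_index r (case p of (j, a, b) \<Rightarrow> park_join r a b))
            (case p of (j, a, b) \<Rightarrow> park_join r a b),
          park_lower r (case p of (j, a, b) \<Rightarrow> park_join r a b)) = p"
      by (simp add: p park_split_index_join[OF a b] park_lower_join[OF a b])
    show "(case p of (j, a, b) \<Rightarrow> park_join r a b) \<in> ?I (Suc k) n"
      using park_join_in[OF a b] j by (simp add: p)
  qed
  also have "\<dots> = (\<Sum>(j, a, b)\<in>(SIGMA j:{0..n}. ?I 1 j \<times> ?I k (n - j)).
      (q_var ^ k) ^ j * ?w 1 a * ?w k b)"
    by (rule sum.cong) (auto simp: weight simp del: mult_smult_left mult_smult_right)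
  also have "\<dots> = (\<Sum>j=0..n. \<Sum>(a, b)\<in>?I 1 j \<times> ?I k (n - j). (q_var ^ k) ^ j * ?w 1 a * ?w k b)"
    by (rule sum.Sigma[symmetric]) (auto intro: finite_increasing_parking_functions)
  also have "\<dots> = (\<Sum>j=0..n. (q_var ^ k) ^ j * park_poly r 1 j * park_poly r k (n - j))"
    unfolding park_poly_def sum.cartesian_product[symmetric] mult.assoc sum_product
    unfolding sum_distrib_left ..
  finally show ?thesis .
qed

text \<open>Extending the family to \<open>k = 0\<close> gives the induction an empty base case: a
  first entry would have to be positive and at most 0.\<close>

lemma park_series_0: "park_series r 0 = 1"
proof (rule fps_ext)
  fix n
  have "n = 0" if "b \<in> increasing_parking_functions r 0 n" for b
  proof (rule ccontr)
    assume "n \<noteq> 0"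
    with that have "0 < b ! 0" "b ! 0 \<le> 0"
      by (auto simp: increasing_parking_functions_iff)
    then show False by simp
  qed
  moreover have "increasing_parking_functions r 0 0 = {[]}"
    by (auto simp: increasing_parking_functions_iff)
  ultimately have "increasing_parking_functions r 0 n = (if n = 0 then {[]} else {})"
    by auto
  then show "park_series r 0 $ n = 1 $ n"
    by (simp add: park_series_def park_poly_def park_h_def park_stat_def numeral_2_eq_2)
qed

text \<open>Substituting \<open>q^k t\<close> for \<open>t\<close> multiplies the coefficient at
  \<open>j\<close> by \<open>(q_var ^ k) ^ j\<close>, so \<open>park_poly_Suc\<close> is this
  product read coefficientwise.\<close>

lemma park_series_Suc:
  "park_series r (Suc k) =
     park_series r k * (park_series r 1 oo (fps_const (q_var ^ k) * fps_X))"
proof (subst mult.commute, rule fps_ext)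
  fix n
  show "park_series r (Suc k) $ n =
      ((park_series r 1 oo (fps_const (q_var ^ k) * fps_X)) * park_series r k) $ n"
    unfolding fps_mult_nth fps_nth_compose_linear park_series_def fps_nth_Abs_fps
    by (rule park_poly_Suc)
qed

theorem theorem3p3:
  fixes r k :: nat
  assumes "0 < r" and "0 < k"
  shows "park_series r k =
    (\<Prod>i = 0..k - 1. (park_series r 1 oo (fps_const (q_var ^ i) * fps_X)))"
proof -
  have "park_series r k = (\<Prod>i<k. (park_series r 1 oo (fps_const (q_var ^ i) * fps_X)))"
    by (induction k) (simp_all only: park_series_0 park_series_Suc prod.lessThan_Suc
        lessThan_0 prod.empty)
  \<comment> \<open>Positivity of \<open>k\<close> enters here: at \<open>k = 0\<close> truncated
    subtraction would make the right side \<open>{0}\<close>.\<close>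
  also have "{..<k} = {0..k - 1}"
    using \<open>0 < k\<close> by auto
  finally show ?thesis .
qed

end
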